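(* For the generalized Bernoulli, Euler and Genocchi polynomials of order $\alpha\in\mathbb{C}$ in the variable $x$, and for every integer $p\ge 0$, with $i^2=-1$, the following lacunary relations of length 4 hold: (1) $$\sum_{\substack{0\le k\le p\\ k\equiv 2\ (\mathrm{mod}\ 4)}}\binom{p}{k}2^{1-k/2}(-1)^{(k+2)/4}B_{p-k}^{(\alpha+1)}(x)=\operatorname{Im}\left(p\,B_{p-1}^{(\alpha)}\left(x-\frac{1+i}{2}\right)\right);$$ (2) $$\sum_{\substack{0\le k\le p\\ k\equiv 0\ (\mathrm{mod}\ 4)}}\binom{p}{k}2^{1-k/2}(-1)^{k/4}E_{p-k}^{(\alpha+1)}(x)=\operatorname{Re}\left(2\,E_{p}^{(\alpha)}\left(x-\frac{1+i}{2}\right)\right);$$ (3) $$\sum_{\substack{0\le k\le p\\ k\equiv 0\ (\mathrm{mod}\ 4)}}\binom{p}{k}2^{1-k/2}(-1)^{k/4}G_{p-k}^{(\alpha+1)}(x)=\operatorname{Re}\left(2p\,G_{p-1}^{(\alpha)}\left(x-\frac{1+i}{2}\right)\right).$$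
   Context: The generalized Bernoulli polynomials $B_k^{(\alpha)}(x)$, Euler polynomials $E_k^{(\alpha)}(x)$ and Genocchi polynomials $G_k^{(\alpha)}(x)$ of order $\alpha\in\mathbb{C}$ are defined by the generating functions $$\left(\frac{t}{e^t-1}\right)^{\alpha}e^{xt}=\sum_{k=0}^\infty B_k^{(\alpha)}(x)\frac{t^k}{k!}\quad(|t|<2\pi),$$ $$\left(\frac{2}{e^t+1}\right)^{\alpha}e^{xt}=\sum_{k=0}^\infty E_k^{(\alpha)}(x)\frac{t^k}{k!}\quad(|t|<\pi),$$ $$\left(\frac{2t}{e^t+1}\right)^{\alpha}e^{xt}=\sum_{k=0}^\infty G_k^{(\alpha)}(x)\frac{t^k}{k!}\quad(|t|<\pi),$$ with $1^\alpha:=1$. Polynomials with negative index are zero by convention. $\operatorname{Re}$ and $\operatorname{Im}$ denote real and imaginary parts.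
   Formalization: Literal Re and Im are used for real α and x (false otherwise: Euler, p=1, α=i, x=0); for complex α, x they mean the part with α, x treated as real indeterminates. Relation (3) is for natural α, the only orders where the Genocchi generating function has a power series. *)

theory Defs
  imports "HOL-Complex_Analysis.Complex_Analysis"
begin

text \<open>
  Only the germ of \<open>f\<close> at 0 enters, with 0 itself left out. So removable singularities such as that
  of \<open>t / (exp t - 1)\<close> need no special treatment, and near 0 the principal power \<open>w powr \<alpha>\<close> of a
  base \<open>w\<close> that tends to 1 is the analytic branch with \<open>1 powr \<alpha> = 1\<close>. (On the whole disc
  \<open>norm t < 2 * pi\<close> the principal power of \<open>t / (exp t - 1)\<close> is not continuous; the analytic
  branch on the disc has the same coefficients as its germ at 0.)
\<close>

definition has_egf :: "(complex \<Rightarrow> complex) \<Rightarrow> (nat \<Rightarrow> complex) \<Rightarrow> bool" where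
  "has_egf f P \<longleftrightarrow> (\<forall>\<^sub>F t in at 0. (\<lambda>k. P k * t ^ k / fact k) sums f t)"

definition egf_coeff :: "(complex \<Rightarrow> complex) \<Rightarrow> nat \<Rightarrow> complex" where
  "egf_coeff f = (THE P. has_egf f P)"

definition bernoulli_gf :: "complex \<Rightarrow> complex \<Rightarrow> complex \<Rightarrow> complex" where
  "bernoulli_gf \<alpha> x t = (t / (exp t - 1)) powr \<alpha> * exp (x * t)"

definition euler_gf :: "complex \<Rightarrow> complex \<Rightarrow> complex \<Rightarrow> complex" where
  "euler_gf \<alpha> x t = (2 / (exp t + 1)) powr \<alpha> * exp (x * t)"

definition genocchi_gf :: "complex \<Rightarrow> complex \<Rightarrow> complex \<Rightarrow> complex" where
  "genocchi_gf \<alpha> x t = (2 * t / (exp t + 1)) powr \<alpha> * exp (x * t)"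

definition gen_bernoulli :: "complex \<Rightarrow> nat \<Rightarrow> complex \<Rightarrow> complex" where
  "gen_bernoulli \<alpha> k x = egf_coeff (bernoulli_gf \<alpha> x) k"

definition gen_euler :: "complex \<Rightarrow> nat \<Rightarrow> complex \<Rightarrow> complex" where
  "gen_euler \<alpha> k x = egf_coeff (euler_gf \<alpha> x) k"

definition gen_genocchi :: "complex \<Rightarrow> nat \<Rightarrow> complex \<Rightarrow> complex" where
  "gen_genocchi \<alpha> k x = egf_coeff (genocchi_gf \<alpha> x) k"

text \<open>
  The base \<open>2 * t / (exp t + 1)\<close> vanishes at 0, so for general \<open>\<alpha>\<close> its power has no expansion in
  nonnegative integer powers of \<open>t\<close>. This predicate singles out the orders for which the Genocchi
  polynomials exist; by \<open>genocchi_order_iff\<close> below they are the natural numbers.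
\<close>

definition genocchi_order :: "complex \<Rightarrow> bool" where
  "genocchi_order \<alpha> \<longleftrightarrow> (\<forall>x. \<exists>P. has_egf (genocchi_gf \<alpha> x) P)"

text \<open>
  Real and imaginary part of a function of \<open>\<alpha>\<close> and \<open>x\<close> with \<open>\<alpha>\<close> and \<open>x\<close> regarded as real
  indeterminates: for a polynomial, the real or imaginary parts of its coefficients are taken. At
  real \<open>\<alpha>\<close> and \<open>x\<close> these are \<open>Re\<close> and \<open>Im\<close> of the value (\<open>Re_part_real\<close>, \<open>Im_part_real\<close>).
\<close>

definition Re_part :: "(complex \<Rightarrow> complex \<Rightarrow> complex) \<Rightarrow> complex \<Rightarrow> complex \<Rightarrow> complex" where
  "Re_part F \<alpha> x = (F \<alpha> x + cnj (F (cnj \<alpha>) (cnj x))) / 2"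

definition Im_part :: "(complex \<Rightarrow> complex \<Rightarrow> complex) \<Rightarrow> complex \<Rightarrow> complex \<Rightarrow> complex" where
  "Im_part F \<alpha> x = (F \<alpha> x - cnj (F (cnj \<alpha>) (cnj x))) / (2 * \<i>)"

lemma Re_part_real: "\<alpha> \<in> \<real> \<Longrightarrow> x \<in> \<real> \<Longrightarrow> Re_part F \<alpha> x = of_real (Re (F \<alpha> x))"
  by (simp add: Re_part_def Reals_cnj_iff complex_add_cnj)

lemma Im_part_real: "\<alpha> \<in> \<real> \<Longrightarrow> x \<in> \<real> \<Longrightarrow> Im_part F \<alpha> x = of_real (Im (F \<alpha> x))"
  by (simp add: Im_part_def Reals_cnj_iff complex_diff_cnj field_simps)

lemma has_egf_iff_laurent:
  "has_egf f P \<longleftrightarrow> f has_laurent_expansion fps_to_fls (Abs_fps (\<lambda>k. P k / fact k))"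
proof -
  define F where "F = Abs_fps (\<lambda>k. P k / fact k)"
  have egf: "has_egf f P \<longleftrightarrow> (\<forall>\<^sub>F t in at 0. (\<lambda>k. fps_nth F k * t ^ k) sums f t)"
    by (simp add: F_def has_egf_def)
  have near: "\<forall>\<^sub>F t in at 0. ereal (norm t) < fps_conv_radius F" if "fps_conv_radius F > 0"
  proof -
    have "\<forall>\<^sub>F t in at 0. t \<in> eball 0 (fps_conv_radius F) - {0}"
      using that by (intro eventually_at_in_open) (auto simp: zero_ereal_def)
    thus ?thesis by eventually_elim auto
  qed
  have "has_egf f P \<longleftrightarrow> f has_laurent_expansion fps_to_fls F"
  proof
    assume "has_egf f P"
    hence ev: "\<forall>\<^sub>F t in at 0. (\<lambda>k. fps_nth F k * t ^ k) sums f t"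
      by (simp add: egf)
    then obtain r where r: "r > 0"
        "\<And>t. t \<noteq> 0 \<Longrightarrow> norm t < r \<Longrightarrow> (\<lambda>k. fps_nth F k * t ^ k) sums f t"
      by (auto simp: eventually_at)
    have "summable (\<lambda>k. fps_nth F k * of_real (r / 2) ^ k)"
      using r(2)[of "of_real (r / 2)"] r(1) by (auto simp: sums_iff)
    hence "conv_radius (fps_nth F) \<ge> norm (of_real (r / 2) :: complex)"
      by (rule conv_radius_geI)
    moreover have "ereal (norm (of_real (r / 2) :: complex)) > 0"
      using r(1) by simp
    ultimately have rad: "fps_conv_radius F > 0"
      unfolding fps_conv_radius_def by (rule order.strict_trans2[rotated])
    have "\<forall>\<^sub>F t in at 0. eval_fls (fps_to_fls F) t = f t"
      using ev near[OF rad]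
      by eventually_elim (simp add: eval_fps_to_fls eval_fps_def sums_iff)
    thus "f has_laurent_expansion fps_to_fls F"
      using rad by (simp add: has_laurent_expansion_def)
  next
    assume "f has_laurent_expansion fps_to_fls F"
    hence rad: "fps_conv_radius F > 0" and ev: "\<forall>\<^sub>F t in at 0. eval_fls (fps_to_fls F) t = f t"
      by (simp_all add: has_laurent_expansion_def)
    show "has_egf f P"
      unfolding egf using ev near[OF rad]
    proof eventually_elim
      case (elim t)
      thus ?case
        using sums_eval_fps[of t F] by (simp add: eval_fps_to_fls)
    qed
  qed
  thus ?thesis by (simp add: F_def)
qed

lemma has_egf_unique:
  assumes "has_egf f P" "has_egf f Q"
  shows "P = Q"
proof
  fix k
  have "Abs_fps (\<lambda>k. P k / fact k) = Abs_fps (\<lambda>k. Q k / fact k)"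
    using has_laurent_expansion_unique[OF assms[unfolded has_egf_iff_laurent]]
    by (simp only: fps_to_fls_eq_iff)
  hence "fps_nth (Abs_fps (\<lambda>k. P k / fact k)) k = fps_nth (Abs_fps (\<lambda>k. Q k / fact k)) k"
    by simp
  thus "P k = Q k" by simp
qed

lemma has_egf_egf_coeff: "has_egf f P \<Longrightarrow> has_egf f (egf_coeff f)"
  unfolding egf_coeff_def
  by (rule theI[of "has_egf f" P]) (assumption, erule has_egf_unique)

lemma has_egf_analytic:
  assumes g: "g analytic_on {0}" and ev: "\<forall>\<^sub>F t in at 0. f t = g t"
  shows "\<exists>P. has_egf f P"
proof -
  define G where "G = fps_expansion g 0"
  define P where "P = (\<lambda>k. fact k * fps_nth G k)"
  have "g has_fps_expansion G"
    unfolding G_def by (rule analytic_at_imp_has_fps_expansion_0[OF g])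
  hence "g has_laurent_expansion fps_to_fls G"
    by (rule has_laurent_expansion_fps)
  hence "f has_laurent_expansion fps_to_fls G"
    unfolding has_laurent_expansion_cong[OF ev refl] .
  moreover have "G = Abs_fps (\<lambda>k. P k / fact k)"
    by (rule fps_ext) (simp add: P_def)
  ultimately have "has_egf f P"
    by (simp add: has_egf_iff_laurent)
  then show ?thesis
    by (intro exI[of _ P])
qed

lemma has_egf_bernoulli: "has_egf (bernoulli_gf \<alpha> x) (\<lambda>k. gen_bernoulli \<alpha> k x)"
proof -
  define h where "h = (\<lambda>t::complex. if t = 0 then 1 else t / (exp t - 1))"
  have ex: "(\<lambda>t::complex. exp t - 1) has_fps_expansion fps_exp 1 - 1"
    by (intro fps_expansion_intros)
  have nz: "fps_nth (fps_exp 1 - 1 :: complex fps) 1 \<noteq> 0" by simp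
  have sub: "subdegree (fps_exp 1 - 1 :: complex fps) = 1"
    by (rule subdegreeI) auto
  have c: "fps_nth (fps_exp 1 - 1 :: complex fps) 1 = 1" by simp
  have "h has_fps_expansion fps_X / (fps_exp 1 - 1)"
    unfolding h_def
    by (rule has_fps_expansion_divide[OF has_fps_expansion_fps_X ex]) (use nz sub c in auto)
  hence "h analytic_on {0}" by (rule has_fps_expansion_imp_analytic_0)
  hence "(\<lambda>t. h t powr \<alpha> * exp (x * t)) analytic_on {0}"
    by (intro analytic_intros) (auto simp: h_def)
  moreover have "\<forall>\<^sub>F t in at 0. bernoulli_gf \<alpha> x t = h t powr \<alpha> * exp (x * t)"
    by (auto simp: bernoulli_gf_def h_def eventually_at_filter)
  ultimately obtain P where "has_egf (bernoulli_gf \<alpha> x) P"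
    using has_egf_analytic by blast
  hence "has_egf (bernoulli_gf \<alpha> x) (egf_coeff (bernoulli_gf \<alpha> x))" by (rule has_egf_egf_coeff)
  thus ?thesis by (simp add: gen_bernoulli_def [abs_def])
qed

lemma has_egf_euler: "has_egf (euler_gf \<alpha> x) (\<lambda>k. gen_euler \<alpha> k x)"
proof -
  have "euler_gf \<alpha> x analytic_on {0}"
    unfolding euler_gf_def by (intro analytic_intros) auto
  then obtain P where "has_egf (euler_gf \<alpha> x) P"
    using has_egf_analytic[of "euler_gf \<alpha> x" "euler_gf \<alpha> x"] by auto
  hence "has_egf (euler_gf \<alpha> x) (egf_coeff (euler_gf \<alpha> x))" by (rule has_egf_egf_coeff)
  thus ?thesis by (simp add: gen_euler_def [abs_def])
qed

lemma has_egf_genocchi: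
  assumes "genocchi_order \<alpha>"
  shows "has_egf (genocchi_gf \<alpha> x) (\<lambda>k. gen_genocchi \<alpha> k x)"
proof -
  obtain P where "has_egf (genocchi_gf \<alpha> x) P"
    using assms by (auto simp: genocchi_order_def)
  hence "has_egf (genocchi_gf \<alpha> x) (egf_coeff (genocchi_gf \<alpha> x))" by (rule has_egf_egf_coeff)
  thus ?thesis by (simp add: gen_genocchi_def [abs_def])
qed

lemma genocchi_order_iff: "genocchi_order \<alpha> \<longleftrightarrow> \<alpha> \<in> \<nat>"
proof
  assume "\<alpha> \<in> \<nat>"
  then obtain n where n: "\<alpha> = of_nat n" by (auto elim: Nats_cases)
  show "genocchi_order \<alpha>"
    unfolding genocchi_order_def
  proof
    fix x
    define g where "g = (\<lambda>t::complex. (2 * t / (exp t + 1)) ^ n * exp (x * t))"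
    have "g analytic_on {0}"
      unfolding g_def by (intro analytic_intros) auto
    moreover have "\<forall>\<^sub>F t in at 0. t \<noteq> 0 \<and> exp t + 1 \<noteq> (0::complex)"
    proof -
      have "((\<lambda>t::complex. exp t + 1) \<longlongrightarrow> exp 0 + 1) (at 0)" by (intro tendsto_intros)
      hence "\<forall>\<^sub>F t in at 0. exp t + 1 \<noteq> (0::complex)"
        by (rule tendsto_imp_eventually_ne) simp
      thus ?thesis by (simp add: eventually_conj_iff eventually_at_filter)
    qed
    hence "\<forall>\<^sub>F t in at 0. genocchi_gf \<alpha> x t = g t"
      by eventually_elim (simp add: genocchi_gf_def g_def n powr_nat')
    ultimately show "\<exists>P. has_egf (genocchi_gf \<alpha> x) P" by (rule has_egf_analytic)
  qed
next
  assume "genocchi_order \<alpha>"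
  define f where "f = genocchi_gf \<alpha> 0"
  obtain P where "has_egf f P"
    using \<open>genocchi_order \<alpha>\<close> by (auto simp: genocchi_order_def f_def)
  define F where "F = Abs_fps (\<lambda>k. P k / fact k)"
  have F: "f has_laurent_expansion fps_to_fls F"
    using \<open>has_egf f P\<close> by (simp add: has_egf_iff_laurent F_def)
  define E where "E = (fps_exp 1 :: complex fps)"
  have E: "exp has_laurent_expansion fps_to_fls E"
    using has_fps_expansion_exp[of "1::complex"] unfolding E_def
    by (intro has_laurent_expansion_fps) simp
  define h where "h = (\<lambda>t. t * deriv f t * (exp t + 1) - \<alpha> * f t * (exp t + 1 - t * exp t))"
  define H where "H = fps_X * fps_deriv F * (E + 1) - fps_const \<alpha> * F * (E + 1 - fps_X * E)"
  have "h has_laurent_expansion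
      fls_X * fls_deriv (fps_to_fls F) * (fps_to_fls E + 1)
        - fls_const \<alpha> * fps_to_fls F * (fps_to_fls E + 1 - fls_X * fps_to_fls E)"
    unfolding h_def by (intro laurent_expansion_intros F E)
  also have "\<dots> = fps_to_fls H"
    by (simp add: H_def fls_deriv_fps_to_fls fls_times_fps_to_fls
        flip: fps_X_to_fls fps_const_to_fls fps_one_to_fls)
  finally have H: "h has_laurent_expansion fps_to_fls H" .

  have ode: "h t = 0" and nz: "f t \<noteq> 0" if t: "t = of_real s" "s > 0" for t s
  proof -
    define w where "w = (\<lambda>t::complex. 2 * t / (exp t + 1))"
    have w: "w t = of_real (2 * s / (exp s + 1))"
      by (simp add: w_def t exp_of_real)
    have pos: "2 * s / (exp s + 1) > 0"
      using t by (intro divide_pos_pos add_pos_pos) auto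
    have wn: "w t \<notin> \<real>\<^sub>\<le>\<^sub>0" unfolding w using pos by (simp only: complex_nonpos_Reals_iff) simp
    have "(of_real (exp s + 1) :: complex) \<noteq> 0"
      using exp_gt_zero[of s] by (metis add_pos_pos of_real_eq_0_iff order_less_irrefl zero_less_one)
    hence e: "exp t + 1 \<noteq> 0" by (simp add: t exp_of_real)
    have t0: "t \<noteq> 0" using t by simp
    have wd: "(w has_field_derivative (2 * (exp t + 1) - 2 * t * exp t) / (exp t + 1)\<^sup>2) (at t)"
      unfolding w_def using e by (auto intro!: derivative_eq_intros simp: power2_eq_square)
    have feq: "f = (\<lambda>t. w t powr \<alpha>)"
      by (simp add: f_def genocchi_gf_def [abs_def] w_def)
    have "(f has_field_derivative \<alpha> * w t powr (\<alpha> - 1) *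
        ((2 * (exp t + 1) - 2 * t * exp t) / (exp t + 1)\<^sup>2)) (at t)"
      unfolding feq
      by (rule DERIV_chain2[OF has_field_derivative_powr[OF wn] wd])
    hence d: "deriv f t = \<alpha> * w t powr (\<alpha> - 1) *
        ((2 * (exp t + 1) - 2 * t * exp t) / (exp t + 1)\<^sup>2)"
      by (rule DERIV_imp_deriv)
    have w0: "w t \<noteq> 0" using e t0 by (simp add: w_def)
    have p: "w t powr (\<alpha> - 1) * w t = f t"
      using w0 by (simp add: feq powr_diff)
    have "t * deriv f t * (exp t + 1) = \<alpha> * (w t powr (\<alpha> - 1) * w t) * (exp t + 1 - t * exp t)"
    proof -
      have "t * (\<alpha> * q * ((2 * u - 2 * t * v) / u\<^sup>2)) * u = \<alpha> * (q * (2 * t / u)) * (u - t * v)"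
        if "u \<noteq> 0" for q u v :: complex
        using that by (simp add: divide_simps power2_eq_square)
      from this[OF e, of "w t powr (\<alpha> - 1)" "exp t"] show ?thesis
        unfolding d by (simp add: w_def)
    qed
    thus "h t = 0" by (simp add: h_def p)
    show "f t \<noteq> 0" using w0 by (simp add: feq)
  qed
  have freq: "\<exists>\<^sub>F t in at (0::complex). t \<in> of_real ` {0<..}"
    unfolding frequently_at
  proof (intro allI impI)
    fix d :: real assume "d > 0"
    thus "\<exists>t\<in>UNIV. t \<noteq> (0::complex) \<and> dist t 0 < d \<and> t \<in> of_real ` {0<..}"
      by (intro bexI[of _ "of_real (d / 2)"] conjI imageI) auto
  qed
  have "H = 0"
  proof (rule ccontr)
    assume "H \<noteq> 0"
    hence "\<forall>\<^sub>F t in at 0. h t \<noteq> 0"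
      using has_laurent_expansion_nonzero_imp_eventually_nonzero[OF H] by simp
    hence "\<forall>\<^sub>F t in at 0. t \<in> complex_of_real ` {0<..} \<longrightarrow> False"
      by eventually_elim (use ode in auto)
    with freq have "\<exists>\<^sub>F t in at (0::complex). False"
      by (rule frequently_rev_mp)
    thus False by simp
  qed
  have "F \<noteq> 0"
  proof
    assume "F = 0"
    hence "\<forall>\<^sub>F t in at 0. 0 = f t"
      using F by (simp add: has_laurent_expansion_def)
    hence "\<forall>\<^sub>F t in at 0. t \<in> complex_of_real ` {0<..} \<longrightarrow> False"
      by eventually_elim (use nz in auto)
    with freq have "\<exists>\<^sub>F t in at (0::complex). False"
      by (rule frequently_rev_mp)
    thus False by simp
  qed
  define n where "n = subdegree F"
  have below: "fps_nth F i = 0" if "i < n" for i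
    using that unfolding n_def by (rule nth_less_subdegree_zero)
  have low: "fps_nth (F * G) n = fps_nth F n * fps_nth G 0" for G
  proof -
    have "fps_nth (F * G) n = (\<Sum>i=0..n. fps_nth F i * fps_nth G (n - i))" by (rule fps_mult_nth)
    also have "\<dots> = (\<Sum>i\<in>{n}. fps_nth F i * fps_nth G (n - i))"
      by (rule sum.mono_neutral_right) (auto simp: below)
    finally show ?thesis by simp
  qed
  have low': "fps_nth (fps_X * fps_deriv F * G) n = of_nat n * fps_nth F n * fps_nth G 0" for G
  proof -
    have nth: "fps_nth (fps_X * fps_deriv F) i = of_nat i * fps_nth F i" for i
      by (cases i) auto
    have "fps_nth (fps_X * fps_deriv F * G) n =
        (\<Sum>i=0..n. of_nat i * fps_nth F i * fps_nth G (n - i))"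
      by (simp only: fps_mult_nth[of "fps_X * fps_deriv F"] nth)
    also have "\<dots> = (\<Sum>i\<in>{n}. of_nat i * fps_nth F i * fps_nth G (n - i))"
      by (rule sum.mono_neutral_right) (auto simp: below)
    finally show ?thesis by simp
  qed
  have "0 = fps_nth H n" by (simp add: \<open>H = 0\<close>)
  also have "\<dots> = 2 * fps_nth F n * (of_nat n - \<alpha>)"
    unfolding H_def fps_sub_nth mult.assoc[of "fps_const \<alpha>"] fps_mult_left_const_nth low low'
    by (simp add: E_def algebra_simps)
  finally have "\<alpha> = of_nat n"
    using \<open>F \<noteq> 0\<close> by (simp add: n_def)
  thus "\<alpha> \<in> \<nat>" by simp
qed

end

theory Submission
  imports Defs
begin

text \<open>
  Let \<open>z = (1 + \<i>) / 2\<close> and \<open>w = cnj z = (1 - \<i>) / 2\<close>. Each family is invariant under simultaneous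
  conjugation of order, argument and value (\<open>cnj_gen_bernoulli\<close>, \<open>cnj_gen_euler\<close> and, at the orders
  where the Genocchi polynomials exist, \<open>cnj_gen_genocchi\<close>), so the
  imaginary part in the Bernoulli relation is a multiple of the difference of the polynomials at
  \<open>x - z\<close> and \<open>x - w\<close>, and the real parts in the other two are multiples of sums.

  What makes these combinations tractable is \<open>z + w = 1\<close>. It gives
  \<open>(exp t - 1) * (exp (- z * t) - exp (- w * t)) = 2 * cosh (w * t) - 2 * cosh (z * t)\<close> and
  \<open>(exp t + 1) * (exp (- z * t) + exp (- w * t)) = 2 * cosh (w * t) + 2 * cosh (z * t)\<close>. The
  first factors on the left are the denominators of \<open>t / (exp t - 1)\<close>, \<open>2 / (exp t + 1)\<close> and
  \<open>2 * t / (exp t + 1)\<close>, which multiply the generating functions when the order is raised by 1; the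
  numerators \<open>t\<close>, \<open>2\<close> and \<open>2 * t\<close> produce the factors \<open>p\<close>, \<open>2\<close> and \<open>2 * p\<close>, and \<open>t\<close> also shifts the
  index from \<open>p\<close> to \<open>p - 1\<close>. Comparing coefficients expresses the combination at order \<open>\<alpha>\<close> as a binomial convolution of the
  polynomials of order \<open>\<alpha> + 1\<close> with \<open>w ^ k + (- w) ^ k \<plusminus> (z ^ k + (- z) ^ k)\<close>
  (\<open>gen_bernoulli_diff\<close>, \<open>gen_euler_add\<close>, \<open>gen_genocchi_add\<close>); this holds for all \<open>z\<close> and \<open>w\<close> with
  \<open>z + w = 1\<close>. Odd \<open>k\<close> drop out. Since \<open>z ^ 2 = \<i> / 2\<close> and \<open>w ^ 2 = - \<i> / 2\<close>, so does every other
  even \<open>k\<close>, and one residue class modulo 4 is left.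
\<close>

section \<open>Calculus of exponential generating functions\<close>

lemma has_egf_cong:
  assumes "has_egf f P" "\<forall>\<^sub>F t in at 0. f t = g t"
  shows "has_egf g P"
  using assms unfolding has_egf_def by eventually_elim simp

lemma has_egf_add:
  assumes "has_egf f P" "has_egf g Q"
  shows "has_egf (\<lambda>t. f t + g t) (\<lambda>k. P k + Q k)"
  using assms unfolding has_egf_def
  by eventually_elim (simp add: sums_add ring_distribs add_divide_distrib)

lemma has_egf_diff:
  assumes "has_egf f P" "has_egf g Q"
  shows "has_egf (\<lambda>t. f t - g t) (\<lambda>k. P k - Q k)"
  using assms unfolding has_egf_def
  by eventually_elim (simp add: sums_diff ring_distribs diff_divide_distrib)

lemma has_egf_exp: "has_egf (\<lambda>t. exp (c * t)) (\<lambda>k. c ^ k)"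
proof -
  have "(\<lambda>k. c ^ k * t ^ k / fact k) sums exp (c * t)" for t
    using exp_converges[of "c * t"]
    by (simp add: scaleR_conv_of_real field_simps power_mult_distrib)
  thus ?thesis by (simp add: has_egf_def)
qed

lemma has_egf_mult_var:
  assumes "has_egf f P"
  shows "has_egf (\<lambda>t. t * f t) (\<lambda>k. of_nat k * P (k - 1))"
  using assms unfolding has_egf_def
proof eventually_elim
  case (elim t)
  have "(\<lambda>k. t * (P k * t ^ k / fact k)) sums (t * f t)"
    using elim by (rule sums_mult)
  hence "(\<lambda>k. of_nat (Suc k) * P (Suc k - 1) * t ^ Suc k / fact (Suc k)) sums (t * f t)"
    by (rule sums_cong[THEN iffD1, rotated]) (simp add: divide_simps del: of_nat_Suc)
  thus ?case
    by (subst (asm) sums_Suc_iff) simp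
qed

lemma has_egf_mult:
  assumes "has_egf f P" "has_egf g Q"
  shows "has_egf (\<lambda>t. f t * g t) (\<lambda>n. \<Sum>k\<le>n. of_nat (n choose k) * P k * Q (n - k))"
proof -
  have "Abs_fps (\<lambda>k. P k / fact k) * Abs_fps (\<lambda>k. Q k / fact k) =
      Abs_fps (\<lambda>n. (\<Sum>k\<le>n. of_nat (n choose k) * P k * Q (n - k)) / fact n)"
    by (rule fps_ext)
      (auto simp: fps_mult_nth atMost_atLeast0 sum_divide_distrib binomial_fact intro!: sum.cong)
  with has_laurent_expansion_mult[OF assms[unfolded has_egf_iff_laurent]]
  show ?thesis
    by (simp add: has_egf_iff_laurent flip: fls_times_fps_to_fls)
qed

lemma has_egf_cnj:
  assumes "has_egf f P"
  shows "has_egf (\<lambda>t. cnj (f (cnj t))) (\<lambda>k. cnj (P k))"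
proof -
  have "filterlim cnj (at 0) (at 0)"
    unfolding filterlim_at
    by (auto simp: eventually_at_filter intro!: tendsto_eq_intros)
  with assms have "\<forall>\<^sub>F t in at 0. (\<lambda>k. P k * cnj t ^ k / fact k) sums f (cnj t)"
    unfolding has_egf_def by (rule eventually_compose_filterlim)
  thus ?thesis
    unfolding has_egf_def
  proof eventually_elim
    case (elim t)
    thus ?case by (subst (asm) sums_cnj[symmetric]) simp
  qed
qed

section \<open>Conjugation symmetry\<close>

lemma cnj_powr: "z \<notin> \<real>\<^sub>\<le>\<^sub>0 \<Longrightarrow> cnj (z powr a) = cnj z powr cnj a"
  by (auto simp: powr_def exp_cnj cnj_Ln)

lemma tendsto_exp_minus_1_over: "((\<lambda>t::complex. (exp t - 1) / t) \<longlongrightarrow> 1) (at 0)"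
  using DERIV_exp[of "0::complex"] by (simp add: DERIV_def)

lemma eventually_exp_minus_1_nonzero: "\<forall>\<^sub>F t in at 0. exp t - 1 \<noteq> (0::complex)"
proof -
  have "\<forall>\<^sub>F t in at 0. (exp t - 1) / t \<noteq> (0::complex)"
    by (rule tendsto_imp_eventually_ne[OF tendsto_exp_minus_1_over]) simp
  thus ?thesis by eventually_elim auto
qed

lemma eventually_exp_plus_1_nonzero: "\<forall>\<^sub>F t in at 0. exp t + 1 \<noteq> (0::complex)"
proof (rule tendsto_imp_eventually_ne)
  show "((\<lambda>t::complex. exp t + 1) \<longlongrightarrow> exp 0 + 1) (at 0)" by (intro tendsto_intros)
qed simp

lemma eventually_not_nonpos_Reals:
  assumes "(f \<longlongrightarrow> (1::complex)) F"
  shows "\<forall>\<^sub>F t in F. f t \<notin> \<real>\<^sub>\<le>\<^sub>0"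
proof -
  have "\<forall>\<^sub>F t in F. f t \<in> - \<real>\<^sub>\<le>\<^sub>0"
    using assms by (rule topological_tendstoD) (simp_all add: open_Compl)
  thus ?thesis by simp
qed

lemma cnj_gen_bernoulli: "cnj (gen_bernoulli (cnj \<alpha>) n (cnj x)) = gen_bernoulli \<alpha> n x"
proof -
  have "((\<lambda>t::complex. inverse ((exp t - 1) / t)) \<longlongrightarrow> inverse 1) (at 0)"
    by (rule tendsto_inverse[OF tendsto_exp_minus_1_over]) simp
  hence "((\<lambda>t::complex. t / (exp t - 1)) \<longlongrightarrow> 1) (at 0)"
    by simp
  hence "\<forall>\<^sub>F t in at 0. t / (exp t - 1) \<notin> (\<real>\<^sub>\<le>\<^sub>0 :: complex set)"
    by (rule eventually_not_nonpos_Reals)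
  hence "\<forall>\<^sub>F t in at 0. bernoulli_gf \<alpha> x t = cnj (bernoulli_gf (cnj \<alpha>) (cnj x) (cnj t))"
  proof eventually_elim
    case (elim t)
    show ?case
      using cnj_powr[OF elim, of \<alpha>, symmetric] by (simp add: bernoulli_gf_def exp_cnj)
  qed
  with has_egf_bernoulli
  have "has_egf (\<lambda>t. cnj (bernoulli_gf (cnj \<alpha>) (cnj x) (cnj t))) (\<lambda>k. gen_bernoulli \<alpha> k x)"
    by (rule has_egf_cong)
  with has_egf_cnj[OF has_egf_bernoulli] show ?thesis
    by (blast dest: has_egf_unique fun_cong)
qed

lemma cnj_gen_euler: "cnj (gen_euler (cnj \<alpha>) n (cnj x)) = gen_euler \<alpha> n x"
proof -
  have "((\<lambda>t::complex. 2 / (exp t + 1)) \<longlongrightarrow> 2 / (exp 0 + 1)) (at 0)"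
    by (intro tendsto_intros) simp
  hence "\<forall>\<^sub>F t in at 0. 2 / (exp t + 1) \<notin> (\<real>\<^sub>\<le>\<^sub>0 :: complex set)"
    by (intro eventually_not_nonpos_Reals) simp
  hence "\<forall>\<^sub>F t in at 0. euler_gf \<alpha> x t = cnj (euler_gf (cnj \<alpha>) (cnj x) (cnj t))"
  proof eventually_elim
    case (elim t)
    show ?case
      using cnj_powr[OF elim, of \<alpha>, symmetric] by (simp add: euler_gf_def exp_cnj)
  qed
  with has_egf_euler
  have "has_egf (\<lambda>t. cnj (euler_gf (cnj \<alpha>) (cnj x) (cnj t))) (\<lambda>k. gen_euler \<alpha> k x)"
    by (rule has_egf_cong)
  with has_egf_cnj[OF has_egf_euler] show ?thesis
    by (blast dest: has_egf_unique fun_cong)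
qed

text \<open>
  The base \<open>2 * t / (exp t + 1)\<close> takes negative real values arbitrarily close to 0, where the
  principal power in general does not commute with conjugation. At a Genocchi order, which is a natural number,
  the power is an ordinary one and no branch is involved.
\<close>

lemma cnj_gen_genocchi:
  assumes "genocchi_order \<alpha>"
  shows "cnj (gen_genocchi (cnj \<alpha>) n (cnj x)) = gen_genocchi \<alpha> n x"
proof -
  obtain m where m: "\<alpha> = of_nat m"
    using assms by (auto simp: genocchi_order_iff elim: Nats_cases)
  have order: "genocchi_order (cnj \<alpha>)"
    using assms by (simp add: m)
  have "\<forall>\<^sub>F t in at (0::complex). t \<noteq> 0"
    by (simp add: eventually_at_filter)
  with eventually_exp_plus_1_nonzero
  have "\<forall>\<^sub>F t in at 0. genocchi_gf \<alpha> x t = cnj (genocchi_gf (cnj \<alpha>) (cnj x) (cnj t))"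
  proof eventually_elim
    case (elim t)
    hence nz: "2 * t / (exp t + 1) \<noteq> 0" by simp
    hence "cnj (2 * t / (exp t + 1)) \<noteq> 0" by (simp only: complex_cnj_zero_iff) simp
    with nz show ?case
      by (simp add: genocchi_gf_def m powr_nat' exp_cnj)
  qed
  with has_egf_genocchi[OF assms]
  have "has_egf (\<lambda>t. cnj (genocchi_gf (cnj \<alpha>) (cnj x) (cnj t))) (\<lambda>k. gen_genocchi \<alpha> k x)"
    by (rule has_egf_cong)
  with has_egf_cnj[OF has_egf_genocchi[OF order]] show ?thesis
    by (blast dest: has_egf_unique fun_cong)
qed

section \<open>Relations between consecutive orders\<close>

text \<open>
  In the next two identities the hypothesis \<open>z + w = 1\<close> enters as
  \<open>exp t * exp (- z * t) = exp (w * t)\<close> and the same with \<open>z\<close> and \<open>w\<close> exchanged.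
\<close>

lemma exp_shift_add:
  fixes z w t :: complex
  assumes "z + w = 1"
  shows "(exp t + 1) * (exp (- z * t) + exp (- w * t)) =
    exp (w * t) + exp (- w * t) + (exp (z * t) + exp (- z * t))"
proof -
  have w: "w = 1 - z" using assms by (simp add: algebra_simps)
  have "exp t * exp (- z * t) = exp (w * t)" "exp t * exp (- w * t) = exp (z * t)"
    by (simp_all add: w algebra_simps flip: exp_add)
  thus ?thesis by (simp add: algebra_simps)
qed

lemma exp_shift_diff:
  fixes z w t :: complex
  assumes "z + w = 1"
  shows "(exp t - 1) * (exp (- z * t) - exp (- w * t)) =
    exp (w * t) + exp (- w * t) - (exp (z * t) + exp (- z * t))"
proof -
  have w: "w = 1 - z" using assms by (simp add: algebra_simps)
  have "exp t * exp (- z * t) = exp (w * t)" "exp t * exp (- w * t) = exp (z * t)"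
    by (simp_all add: w algebra_simps flip: exp_add)
  thus ?thesis by (simp add: algebra_simps)
qed

lemma gen_bernoulli_diff:
  assumes zw: "z + w = 1"
  shows "of_nat p * gen_bernoulli \<alpha> (p - 1) (x - z) - of_nat p * gen_bernoulli \<alpha> (p - 1) (x - w) =
    (\<Sum>k\<le>p. of_nat (p choose k) * (w ^ k + (- w) ^ k - (z ^ k + (- z) ^ k)) *
      gen_bernoulli (\<alpha> + 1) (p - k) x)"
proof -
  define H where "H = (\<lambda>t. exp (w * t) + exp (- w * t) - (exp (z * t) + exp (- z * t)))"
  have "\<forall>\<^sub>F t in at (0::complex). t \<noteq> 0"
    by (simp add: eventually_at_filter)
  with eventually_exp_minus_1_nonzero
  have "\<forall>\<^sub>F t in at 0. t * bernoulli_gf \<alpha> (x - z) t - t * bernoulli_gf \<alpha> (x - w) t =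
      H t * bernoulli_gf (\<alpha> + 1) x t"
  proof eventually_elim
    case (elim t)
    \<comment> \<open>The base of the generating function; raising the order by 1 multiplies by it.\<close>
    define b where "b = t / (exp t - 1)"
    have b: "b powr (\<alpha> + 1) = b powr \<alpha> * b" and t: "t = b * (exp t - 1)"
      using elim by (simp_all add: b_def powr_add)
    have e: "exp ((x - a) * t) = exp (x * t) * exp (- a * t)" for a
      by (simp add: algebra_simps flip: exp_add)
    have "t * bernoulli_gf \<alpha> (x - z) t - t * bernoulli_gf \<alpha> (x - w) t =
        t * (b powr \<alpha> * exp (x * t) * (exp (- z * t) - exp (- w * t)))"
      unfolding bernoulli_gf_def e b_def by (simp add: algebra_simps)
    also have "\<dots> = b * (exp t - 1) * (b powr \<alpha> * exp (x * t) * (exp (- z * t) - exp (- w * t)))"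
      using t by simp
    also have "\<dots> = H t * bernoulli_gf (\<alpha> + 1) x t"
      unfolding H_def exp_shift_diff[OF zw, symmetric] bernoulli_gf_def
      unfolding b_def[symmetric] b by (simp only: mult_ac)
    finally show ?case .
  qed
  moreover have "has_egf (\<lambda>t. t * bernoulli_gf \<alpha> (x - z) t - t * bernoulli_gf \<alpha> (x - w) t)
      (\<lambda>n. of_nat n * gen_bernoulli \<alpha> (n - 1) (x - z)
        - of_nat n * gen_bernoulli \<alpha> (n - 1) (x - w))"
    by (intro has_egf_diff has_egf_mult_var has_egf_bernoulli)
  ultimately have "has_egf (\<lambda>t. H t * bernoulli_gf (\<alpha> + 1) x t)
      (\<lambda>n. of_nat n * gen_bernoulli \<alpha> (n - 1) (x - z)
        - of_nat n * gen_bernoulli \<alpha> (n - 1) (x - w))"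
    by (rule has_egf_cong[rotated])
  moreover have "has_egf H (\<lambda>k. w ^ k + (- w) ^ k - (z ^ k + (- z) ^ k))"
    unfolding H_def by (intro has_egf_diff has_egf_add has_egf_exp)
  from has_egf_mult[OF this has_egf_bernoulli]
  have "has_egf (\<lambda>t. H t * bernoulli_gf (\<alpha> + 1) x t)
      (\<lambda>n. \<Sum>k\<le>n. of_nat (n choose k) * (w ^ k + (- w) ^ k - (z ^ k + (- z) ^ k)) *
        gen_bernoulli (\<alpha> + 1) (n - k) x)" .
  ultimately show ?thesis
    by (blast dest: has_egf_unique fun_cong)
qed

lemma gen_euler_add:
  assumes zw: "z + w = 1"
  shows "2 * gen_euler \<alpha> p (x - z) + 2 * gen_euler \<alpha> p (x - w) =
    (\<Sum>k\<le>p. of_nat (p choose k) * (w ^ k + (- w) ^ k + (z ^ k + (- z) ^ k)) *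
      gen_euler (\<alpha> + 1) (p - k) x)"
proof -
  define H where "H = (\<lambda>t. exp (w * t) + exp (- w * t) + (exp (z * t) + exp (- z * t)))"
  from eventually_exp_plus_1_nonzero
  have "\<forall>\<^sub>F t in at 0. euler_gf \<alpha> (x - z) t + euler_gf \<alpha> (x - z) t
      + (euler_gf \<alpha> (x - w) t + euler_gf \<alpha> (x - w) t) = H t * euler_gf (\<alpha> + 1) x t"
  proof eventually_elim
    case (elim t)
    define b where "b = 2 / (exp t + 1)"
    have b: "b powr (\<alpha> + 1) = b powr \<alpha> * b" and t: "2 = b * (exp t + 1)"
      using elim by (simp_all only: b_def powr_add) (simp_all add: field_simps)
    have e: "exp ((x - a) * t) = exp (x * t) * exp (- a * t)" for a
      by (simp add: algebra_simps flip: exp_add)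
    have "euler_gf \<alpha> (x - z) t + euler_gf \<alpha> (x - z) t
        + (euler_gf \<alpha> (x - w) t + euler_gf \<alpha> (x - w) t) =
        2 * (b powr \<alpha> * exp (x * t) * (exp (- z * t) + exp (- w * t)))"
      unfolding euler_gf_def e b_def by (simp add: algebra_simps)
    also have "\<dots> = b * (exp t + 1) * (b powr \<alpha> * exp (x * t) * (exp (- z * t) + exp (- w * t)))"
      using t by simp
    also have "\<dots> = H t * euler_gf (\<alpha> + 1) x t"
      unfolding H_def exp_shift_add[OF zw, symmetric] euler_gf_def
      unfolding b_def[symmetric] b by (simp only: mult_ac)
    finally show ?case .
  qed
  moreover have "has_egf (\<lambda>t. euler_gf \<alpha> (x - z) t + euler_gf \<alpha> (x - z) t
        + (euler_gf \<alpha> (x - w) t + euler_gf \<alpha> (x - w) t))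
      (\<lambda>n. gen_euler \<alpha> n (x - z) + gen_euler \<alpha> n (x - z)
        + (gen_euler \<alpha> n (x - w) + gen_euler \<alpha> n (x - w)))"
    by (intro has_egf_add has_egf_euler)
  ultimately have "has_egf (\<lambda>t. H t * euler_gf (\<alpha> + 1) x t)
      (\<lambda>n. gen_euler \<alpha> n (x - z) + gen_euler \<alpha> n (x - z)
        + (gen_euler \<alpha> n (x - w) + gen_euler \<alpha> n (x - w)))"
    by (rule has_egf_cong[rotated])
  moreover have "has_egf H (\<lambda>k. w ^ k + (- w) ^ k + (z ^ k + (- z) ^ k))"
    unfolding H_def by (intro has_egf_add has_egf_exp)
  from has_egf_mult[OF this has_egf_euler]
  have "has_egf (\<lambda>t. H t * euler_gf (\<alpha> + 1) x t)
      (\<lambda>n. \<Sum>k\<le>n. of_nat (n choose k) * (w ^ k + (- w) ^ k + (z ^ k + (- z) ^ k)) *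
        gen_euler (\<alpha> + 1) (n - k) x)" .
  ultimately show ?thesis
    unfolding mult_2 by (blast dest: has_egf_unique fun_cong)
qed

lemma gen_genocchi_add:
  assumes zw: "z + w = 1" and order: "genocchi_order \<alpha>"
  shows "2 * of_nat p * gen_genocchi \<alpha> (p - 1) (x - z)
      + 2 * of_nat p * gen_genocchi \<alpha> (p - 1) (x - w) =
    (\<Sum>k\<le>p. of_nat (p choose k) * (w ^ k + (- w) ^ k + (z ^ k + (- z) ^ k)) *
      gen_genocchi (\<alpha> + 1) (p - k) x)"
proof -
  define H where "H = (\<lambda>t. exp (w * t) + exp (- w * t) + (exp (z * t) + exp (- z * t)))"
  define g where "g = (\<lambda>t. genocchi_gf \<alpha> (x - z) t + genocchi_gf \<alpha> (x - w) t)"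
  define G where "G = (\<lambda>n. gen_genocchi \<alpha> n (x - z) + gen_genocchi \<alpha> n (x - w))"
  have order': "genocchi_order (\<alpha> + 1)"
    using order by (simp add: genocchi_order_iff)
  have "\<forall>\<^sub>F t in at (0::complex). t \<noteq> 0"
    by (simp add: eventually_at_filter)
  with eventually_exp_plus_1_nonzero
  have "\<forall>\<^sub>F t in at 0. t * (g t + g t) = H t * genocchi_gf (\<alpha> + 1) x t"
  proof eventually_elim
    case (elim t)
    define b where "b = 2 * t / (exp t + 1)"
    have b: "b powr (\<alpha> + 1) = b powr \<alpha> * b" and t: "2 * t = b * (exp t + 1)"
      using elim by (simp_all add: b_def powr_add)
    have e: "exp ((x - a) * t) = exp (x * t) * exp (- a * t)" for a
      by (simp add: algebra_simps flip: exp_add)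
    have "t * (g t + g t) = 2 * t * (b powr \<alpha> * exp (x * t) * (exp (- z * t) + exp (- w * t)))"
      unfolding g_def genocchi_gf_def e b_def by (simp add: algebra_simps)
    also have "\<dots> = b * (exp t + 1) * (b powr \<alpha> * exp (x * t) * (exp (- z * t) + exp (- w * t)))"
      unfolding t ..
    also have "\<dots> = H t * genocchi_gf (\<alpha> + 1) x t"
      unfolding H_def exp_shift_add[OF zw, symmetric] genocchi_gf_def
      unfolding b_def[symmetric] b by (simp only: mult_ac)
    finally show ?case .
  qed
  moreover have "has_egf (\<lambda>t. t * (g t + g t)) (\<lambda>n. of_nat n * (G (n - 1) + G (n - 1)))"
    unfolding g_def G_def by (intro has_egf_mult_var has_egf_add has_egf_genocchi order)
  ultimately have "has_egf (\<lambda>t. H t * genocchi_gf (\<alpha> + 1) x t)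
      (\<lambda>n. of_nat n * (G (n - 1) + G (n - 1)))"
    by (rule has_egf_cong[rotated])
  moreover have "has_egf H (\<lambda>k. w ^ k + (- w) ^ k + (z ^ k + (- z) ^ k))"
    unfolding H_def by (intro has_egf_add has_egf_exp)
  from has_egf_mult[OF this has_egf_genocchi[OF order']]
  have "has_egf (\<lambda>t. H t * genocchi_gf (\<alpha> + 1) x t)
      (\<lambda>n. \<Sum>k\<le>n. of_nat (n choose k) * (w ^ k + (- w) ^ k + (z ^ k + (- z) ^ k)) *
        gen_genocchi (\<alpha> + 1) (n - k) x)" .
  ultimately have "of_nat p * (G (p - 1) + G (p - 1)) =
    (\<Sum>k\<le>p. of_nat (p choose k) * (w ^ k + (- w) ^ k + (z ^ k + (- z) ^ k)) *
      gen_genocchi (\<alpha> + 1) (p - k) x)"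
    by (blast dest: has_egf_unique fun_cong)
  thus ?thesis by (simp add: G_def algebra_simps)
qed

section \<open>Lacunary coefficients and the length 4 relations\<close>

lemma sum_lacunary:
  fixes c d b :: "nat \<Rightarrow> complex"
  assumes "\<And>k. c k = (if k mod 4 = r then a * d k else 0)"
  shows "(\<Sum>k\<le>p. of_nat (p choose k) * c k * b k) =
    a * (\<Sum>k | k \<le> p \<and> k mod 4 = r. of_nat (p choose k) * d k * b k)"
proof -
  have "(\<Sum>k\<le>p. of_nat (p choose k) * c k * b k) =
      (\<Sum>k | k \<le> p \<and> k mod 4 = r. of_nat (p choose k) * c k * b k)"
    by (rule sum.mono_neutral_right) (auto simp: assms)
  thus ?thesis
    by (auto simp: assms sum_distrib_left mult_ac intro!: sum.cong)
qed

lemma powr_minus_double: "2 powr (- (2 * of_nat m)) = (1 / 4 :: complex) ^ m"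
proof -
  have "2 powr (- (2 * of_nat m)) = 1 / (2 :: complex) powr of_nat (2 * m)"
    by (simp add: powr_minus_divide)
  also have "\<dots> = 1 / 2 ^ (2 * m)"
    by (subst powr_nat') simp_all
  finally show ?thesis by (simp add: power_mult power_divide)
qed

text \<open>
  The coefficients of the convolutions at \<open>z = (1 + \<i>) / 2\<close> and \<open>w = (1 - \<i>) / 2\<close> follow from
  \<open>z ^ 4 = w ^ 4 = - 1 / 4\<close> and
  \<open>z ^ 2 = \<i> / 2 = - (w ^ 2)\<close>.
\<close>

lemma power2_half: "((1 + \<i>) / 2)\<^sup>2 = \<i> / 2" "((1 - \<i>) / 2)\<^sup>2 = - \<i> / 2"
  by (simp_all add: complex_eq_iff power2_eq_square)

lemma power4_half: "((1 + \<i>) / 2) ^ 4 = - 1 / 4" "((1 - \<i>) / 2) ^ 4 = - 1 / 4"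
  by (simp_all add: complex_eq_iff eval_nat_numeral)

lemma power_half_sum:
  "((1 - \<i>) / 2) ^ k + (- ((1 - \<i>) / 2)) ^ k + (((1 + \<i>) / 2) ^ k + (- ((1 + \<i>) / 2)) ^ k) =
    (if k mod 4 = 0 then 2 * (2 powr (1 - of_nat k / 2) * (-1) ^ (k div 4)) else 0)"
proof (cases "even k")
  case False
  hence "k mod 4 \<noteq> 0" by presburger
  with False show ?thesis by simp
next
  case True
  define m where "m = k div 4"
  have k: "k = 4 * m \<or> k = 4 * m + 2"
    using True unfolding m_def by presburger
  have q: "(- 1 / 4 :: complex) ^ m = (- 1) ^ m * (1 / 4) ^ m"
    by (simp flip: power_mult_distrib)
  have p: "2 powr (1 - 2 * of_nat m) = 2 * (1 / 4 :: complex) ^ m"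
    using powr_add[of "2 :: complex" 1 "- (2 * of_nat m)"] by (simp add: powr_minus_double)
  from k show ?thesis
  proof
    assume k: "k = 4 * m"
    show ?thesis
      using q by (simp add: k power_mult power4_half p)
  next
    assume k: "k = 4 * m + 2"
    have "k mod 4 \<noteq> 0" using k by presburger
    moreover have "((1 - \<i>) / 2) ^ k = - (((1 + \<i>) / 2) ^ k)"
      unfolding k power_add power_mult power4_half power2_half by simp
    ultimately show ?thesis
      using True by simp
  qed
qed

lemma power_half_diff:
  "((1 - \<i>) / 2) ^ k + (- ((1 - \<i>) / 2)) ^ k - (((1 + \<i>) / 2) ^ k + (- ((1 + \<i>) / 2)) ^ k) =
    (if k mod 4 = 2 then 2 * \<i> * (2 powr (1 - of_nat k / 2) * (-1) ^ ((k + 2) div 4)) else 0)"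
proof (cases "even k")
  case False
  hence "k mod 4 \<noteq> 2" by presburger
  with False show ?thesis by simp
next
  case True
  define m where "m = k div 4"
  have k: "k = 4 * m \<or> k = 4 * m + 2"
    using True unfolding m_def by presburger
  have q: "(- 1 / 4 :: complex) ^ m = (- 1) ^ m * (1 / 4) ^ m"
    by (simp flip: power_mult_distrib)
  from k show ?thesis
  proof
    assume k: "k = 4 * m"
    show ?thesis
      by (simp add: k power_mult power4_half)
  next
    assume k: "k = 4 * m + 2"
    have e: "1 - of_nat (4 * m + 2) / 2 = (- (2 * of_nat m) :: complex)"
      by (simp add: field_simps)
    have d: "(4 * m + 2) mod 4 = 2" "(4 * m + 2 + 2) div 4 = Suc m"
      by presburger+
    have "(if k mod 4 = 2 then 2 * \<i> * (2 powr (1 - of_nat k / 2) * (-1) ^ ((k + 2) div 4)) else 0)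
        = 2 * \<i> * ((1 / 4) ^ m * (- 1) ^ Suc m)"
      unfolding k d e powr_minus_double by simp
    also have "\<dots> = - 2 * \<i> * (- 1 / 4) ^ m"
      unfolding q by simp
    finally show ?thesis
      unfolding power_minus_even[OF True]
      unfolding k power_add power_mult power4_half power2_half by (simp add: algebra_simps)
  qed
qed

theorem corollary3:
  fixes \<alpha> x :: complex and p :: nat
  shows
    "(\<alpha> \<in> \<real> \<and> x \<in> \<real> \<longrightarrow>
        (\<Sum>k | k \<le> p \<and> k mod 4 = 2. of_nat (p choose k) * 2 powr (1 - of_nat k / 2) *
            (-1) ^ ((k + 2) div 4) * gen_bernoulli (\<alpha> + 1) (p - k) x)
          = of_real (Im (of_nat p * gen_bernoulli \<alpha> (p - 1) (x - (1 + \<i>) / 2)))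
      \<and> (\<Sum>k | k \<le> p \<and> k mod 4 = 0. of_nat (p choose k) * 2 powr (1 - of_nat k / 2) *
            (-1) ^ (k div 4) * gen_euler (\<alpha> + 1) (p - k) x)
          = of_real (Re (2 * gen_euler \<alpha> p (x - (1 + \<i>) / 2)))
      \<and> (genocchi_order \<alpha> \<longrightarrow>
          (\<Sum>k | k \<le> p \<and> k mod 4 = 0. of_nat (p choose k) * 2 powr (1 - of_nat k / 2) *
            (-1) ^ (k div 4) * gen_genocchi (\<alpha> + 1) (p - k) x)
          = of_real (Re (2 * of_nat p * gen_genocchi \<alpha> (p - 1) (x - (1 + \<i>) / 2)))))
    \<and> (\<Sum>k | k \<le> p \<and> k mod 4 = 2. of_nat (p choose k) * 2 powr (1 - of_nat k / 2) *
          (-1) ^ ((k + 2) div 4) * gen_bernoulli (\<alpha> + 1) (p - k) x)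
        = Im_part (\<lambda>\<alpha> x. of_nat p * gen_bernoulli \<alpha> (p - 1) (x - (1 + \<i>) / 2)) \<alpha> x
    \<and> (\<Sum>k | k \<le> p \<and> k mod 4 = 0. of_nat (p choose k) * 2 powr (1 - of_nat k / 2) *
          (-1) ^ (k div 4) * gen_euler (\<alpha> + 1) (p - k) x)
        = Re_part (\<lambda>\<alpha> x. 2 * gen_euler \<alpha> p (x - (1 + \<i>) / 2)) \<alpha> x
    \<and> (genocchi_order \<alpha> \<longrightarrow>
        (\<Sum>k | k \<le> p \<and> k mod 4 = 0. of_nat (p choose k) * 2 powr (1 - of_nat k / 2) *
          (-1) ^ (k div 4) * gen_genocchi (\<alpha> + 1) (p - k) x)
        = Re_part (\<lambda>\<alpha> x. 2 * of_nat p * gen_genocchi \<alpha> (p - 1) (x - (1 + \<i>) / 2)) \<alpha> x)"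
proof -
  have half: "(1 + \<i>) / 2 + (1 - \<i>) / 2 = (1 :: complex)"
    by (simp add: field_simps)
  have cnj_shift: "cnj x - (1 + \<i>) / 2 = cnj (x - (1 - \<i>) / 2)"
    by simp
  let ?B = "\<lambda>\<alpha> x. of_nat p * gen_bernoulli \<alpha> (p - 1) (x - (1 + \<i>) / 2)"
  let ?E = "\<lambda>\<alpha> x. 2 * gen_euler \<alpha> p (x - (1 + \<i>) / 2)"
  let ?G = "\<lambda>\<alpha> x. 2 * of_nat p * gen_genocchi \<alpha> (p - 1) (x - (1 + \<i>) / 2)"
  have B: "(\<Sum>k | k \<le> p \<and> k mod 4 = 2. of_nat (p choose k) * 2 powr (1 - of_nat k / 2) *
      (-1) ^ ((k + 2) div 4) * gen_bernoulli (\<alpha> + 1) (p - k) x) = Im_part ?B \<alpha> x"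
    unfolding Im_part_def cnj_shift complex_cnj_mult cnj_gen_bernoulli
    unfolding complex_cnj_of_nat gen_bernoulli_diff[OF half]
      sum_lacunary[OF power_half_diff, of p "\<lambda>k. gen_bernoulli (\<alpha> + 1) (p - k) x"]
    by (simp add: mult.assoc)
  have E: "(\<Sum>k | k \<le> p \<and> k mod 4 = 0. of_nat (p choose k) * 2 powr (1 - of_nat k / 2) *
      (-1) ^ (k div 4) * gen_euler (\<alpha> + 1) (p - k) x) = Re_part ?E \<alpha> x"
    unfolding Re_part_def cnj_shift complex_cnj_mult cnj_gen_euler
    unfolding complex_cnj_numeral gen_euler_add[OF half]
      sum_lacunary[OF power_half_sum, of p "\<lambda>k. gen_euler (\<alpha> + 1) (p - k) x"]
    by (simp add: mult.assoc)
  have G: "(\<Sum>k | k \<le> p \<and> k mod 4 = 0. of_nat (p choose k) * 2 powr (1 - of_nat k / 2) *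
      (-1) ^ (k div 4) * gen_genocchi (\<alpha> + 1) (p - k) x) = Re_part ?G \<alpha> x"
    if order: "genocchi_order \<alpha>"
    unfolding Re_part_def cnj_shift complex_cnj_mult cnj_gen_genocchi[OF order]
    unfolding complex_cnj_numeral complex_cnj_of_nat gen_genocchi_add[OF half order]
      sum_lacunary[OF power_half_sum, of p "\<lambda>k. gen_genocchi (\<alpha> + 1) (p - k) x"]
    by (simp add: mult.assoc)
  have "Im_part ?B \<alpha> x = of_real (Im (?B \<alpha> x))" "Re_part ?E \<alpha> x = of_real (Re (?E \<alpha> x))"
      "Re_part ?G \<alpha> x = of_real (Re (?G \<alpha> x))" if "\<alpha> \<in> \<real> \<and> x \<in> \<real>"
    using that by (blast intro: Im_part_real Re_part_real)+
  note real = trans[OF B this(1)] trans[OF E this(2)] trans[OF G this(3)]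
  show ?thesis
    by (intro conjI impI real B E G) simp_all
qed

end
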